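(* For every graph $G$ and every $d\in\mathbb{N}$, we have $\chi_{\mathrm{sub}}(G^d)\leq \mathrm{wcol}_{2d}(G)$.
   Context: All graphs are finite, simple and undirected. $G^d$ is the graph on $V(G)$ where distinct $u,v$ are adjacent iff their distance in $G$ is at most $d$. The subchromatic index $\chi_{\mathrm{sub}}(H)$ of a graph $H$ is the least integer $c$ such that $V(H)$ can be colored with $c$ colors so that each color class induces a disjoint union of complete graphs. For a vertex ordering (linear order) $\sigma$ of $G$, $r\in\mathbb{N}$, and vertices $v\leq_\sigma u$, $v$ is weakly $r$-reachable from $u$ if there is a path of length at most $r$ from $u$ to $v$ all of whose vertices are not placed before $v$ in $\sigma$; $\mathrm{WReach}_r[G,\sigma,u]$ is the set of such $v$ (including $u$); $\mathrm{wcol}_r(G,\sigma)=\max_u|\mathrm{WReach}_r[G,\sigma,u]|$ and $\mathrm{wcol}_r(G)=\min_\sigma \mathrm{wcol}_r(G,\sigma)$. *)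

theory Defs
  imports Graph_Theory.Graph_Theory "HOL-Library.Disjoint_Sets"
begin

text \<open>
  A finite simple undirected graph is a pre-digraph \<open>G\<close> with \<^locale>\<open>graph\<close> \<open>G\<close>: finite, symmetric,
  without loops and without parallel arcs. An edge \<open>{u, v}\<close> is the pair of arcs \<open>u \<rightarrow> v\<close>, \<open>v \<rightarrow> u\<close>.
\<close>

text \<open>The distance is \<open>\<infinity>\<close> for vertices in different components.\<close>

definition graph_dist :: "('a, 'b) pre_digraph \<Rightarrow> 'a \<Rightarrow> 'a \<Rightarrow> ereal" where
  "graph_dist G u v = wf_digraph.\<mu> G (\<lambda>_. 1) u v"

definition graph_power :: "('a, 'b) pre_digraph \<Rightarrow> nat \<Rightarrow> 'a pair_pre_digraph" where
  "graph_power G d = \<lparr> pverts = verts G,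
     parcs = {(u, v). u \<in> verts G \<and> v \<in> verts G \<and> u \<noteq> v \<and> graph_dist G u v \<le> ereal (real d)} \<rparr>"

definition disjoint_union_of_complete :: "('a, 'b) pre_digraph \<Rightarrow> bool" where
  "disjoint_union_of_complete H \<longleftrightarrow>
     (\<exists>P. partition_on (verts H) P \<and>
          (\<forall>C\<in>P. complete_digraph (card C) (H \<restriction> C)) \<and>
          (\<forall>(u, v)\<in>arcs_ends H. \<exists>C\<in>P. u \<in> C \<and> v \<in> C))"

definition subcoloring :: "('a, 'b) pre_digraph \<Rightarrow> nat \<Rightarrow> ('a \<Rightarrow> nat) \<Rightarrow> bool" where
  "subcoloring H c f \<longleftrightarrow>
     (\<forall>v\<in>verts H. f v < c) \<and>
     (\<forall>i<c. disjoint_union_of_complete (H \<restriction> {v \<in> verts H. f v = i}))"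

definition subchromatic_index :: "('a, 'b) pre_digraph \<Rightarrow> nat" where
  "subchromatic_index H = (LEAST c. \<exists>f. subcoloring H c f)"

text \<open>
  A vertex ordering is a relation \<open>\<sigma>\<close> with \<^term>\<open>linear_order_on (verts G) \<sigma>\<close>, where
  \<^term>\<open>(v, u) \<in> \<sigma>\<close> means \<open>v \<le> u\<close>; \<^term>\<open>underS \<sigma> v\<close> is the set of vertices strictly before \<open>v\<close>.
  Paths (\<open>apath\<close>) do not repeat vertices and are given by their list of arcs, so that
  \<^term>\<open>length p\<close> counts edges; the empty path shows that \<open>u\<close> is reachable from itself.
\<close>

definition WReach :: "('a, 'b) pre_digraph \<Rightarrow> nat \<Rightarrow> 'a rel \<Rightarrow> 'a \<Rightarrow> 'a set" where
  "WReach G r \<sigma> u =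
     {v \<in> verts G. (v, u) \<in> \<sigma> \<and>
        (\<exists>p. pre_digraph.apath G u p v \<and> length p \<le> r \<and>
             (\<forall>w\<in>set (pre_digraph.awalk_verts G u p). w \<notin> underS \<sigma> v))}"

text \<open>The inserted \<open>0\<close> only matters for the graph without vertices, where the maximum is \<open>0\<close>.\<close>

definition wcol_of_order :: "('a, 'b) pre_digraph \<Rightarrow> nat \<Rightarrow> 'a rel \<Rightarrow> nat" where
  "wcol_of_order G r \<sigma> = Max (insert 0 ((\<lambda>u. card (WReach G r \<sigma> u)) ` verts G))"

definition wcol :: "('a, 'b) pre_digraph \<Rightarrow> nat \<Rightarrow> nat" where
  "wcol G r = Min (wcol_of_order G r ` {\<sigma>. linear_order_on (verts G) \<sigma>})"

end

(*
  Fix an order witnessing wcol_{2d}, put k = d div 2 and let m(u) be the least vertex of the ball of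
  radius k around u. Vertices with the same m are at distance at most 2k <= d. If u and v are at
  distance at most d <= 2k + 1, then a shortest path between them stays in the union of their k-balls,
  so the walk m(u) - u - v - m(v), of length at most 2k + d <= 2d, does so too and hence never goes
  below the smaller of m(u) and m(v), which is therefore weakly 2d-reachable from the other one.
  So if f is the greedy colouring, which separates each vertex from those it weakly reaches,
  then each colour class of f o m is split by the values of m into cliques without edges between them.
*)
theory Submission
  imports Defs
begin

section \<open>Greedy colouring and least elements\<close>

lemma wf_greedy_coloring:
  assumes "wf r"
    and "\<And>v. v \<in> A \<Longrightarrow> finite (r\<inverse> `` {v}) \<and> card (r\<inverse> `` {v}) < c"
  obtains f :: "'a \<Rightarrow> nat" where "\<And>v. v \<in> A \<Longrightarrow> f v < c"
    and "\<And>v w. v \<in> A \<Longrightarrow> (w, v) \<in> r \<Longrightarrow> f w \<noteq> f v"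
proof -
  define F where "F g v = (LEAST n. n \<notin> g ` (r\<inverse> `` {v}))" for g :: "'a \<Rightarrow> nat" and v
  define f where "f = wfrec r F"
  \<comment> \<open>\<open>F\<close> inspects its argument only at predecessors of \<open>v\<close>,
    where \<open>cut f r v\<close> agrees with \<open>f\<close>, so the recursion equation holds
    without the cut.\<close>
  have "F (cut f r v) v = F f v" for v
    using image_cong[of "r\<inverse> `` {v}" _ "cut f r v" f] by (simp add: F_def cut_apply)
  then have f: "f v = F f v" for v
    using wfrec[OF \<open>wf r\<close>, of F v] by (simp add: f_def)
  have *: "f v < c \<and> f v \<notin> f ` (r\<inverse> `` {v})" if "v \<in> A" for v
  proof -
    let ?X = "f ` (r\<inverse> `` {v})"
    have fin: "finite ?X" and "card ?X < c"
      using assms(2)[OF that] card_image_le[of "r\<inverse> `` {v}" f] by auto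
    then have "\<not> {..<c} \<subseteq> ?X"
      using card_mono[OF fin, of "{..<c}"] by auto
    then obtain n where n: "n < c" "n \<notin> ?X" by auto
    have "(LEAST n. n \<notin> ?X) \<notin> ?X" "(LEAST n. n \<notin> ?X) \<le> n"
      by (fact LeastI[of "\<lambda>n. n \<notin> ?X", OF n(2)], fact Least_le[of "\<lambda>n. n \<notin> ?X", OF n(2)])
    then show ?thesis using n(1) by (simp add: f[of v] F_def)
  qed
  show thesis
  proof (rule that[of f])
    show "f v < c" if "v \<in> A" for v using * that by blast
    show "f w \<noteq> f v" if "v \<in> A" "(w, v) \<in> r" for v w
      using *[OF that(1)] that(2) by (metis ImageI converseI imageI singletonI)
  qed
qed

lemma linear_order_on_finite_least:
  assumes "linear_order_on A \<sigma>" "finite S" "S \<noteq> {}" "S \<subseteq> A"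
  shows "\<exists>x\<in>S. \<forall>y\<in>S. (x, y) \<in> \<sigma>"
  using assms(2-)
proof (induction rule: finite_ne_induct)
  case (singleton x)
  then show ?case
    using assms(1) by (auto simp: order_on_defs refl_on_def)
next
  case (insert x S)
  then obtain z where z: "z \<in> S" "\<forall>y\<in>S. (z, y) \<in> \<sigma>" by auto
  from assms(1) have "refl_on A \<sigma>" "trans \<sigma>" "total_on A \<sigma>" by (auto simp: order_on_defs)
  with insert z(1) have "(x, x) \<in> \<sigma>" "(x, z) \<in> \<sigma> \<or> (z, x) \<in> \<sigma>"
    by (auto simp: refl_on_def total_on_def)
  with z \<open>trans \<sigma>\<close> show ?case by (auto dest: transD)
qed

section \<open>Balls and confined walks in terms of relation powers\<close>

lemma sym_relpow:
  assumes "sym E" "(x, y) \<in> E ^^ n"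
  shows "(y, x) \<in> E ^^ n"
  using assms(2)
proof (induction n arbitrary: y)
  case (Suc n)
  then obtain w where "(w, x) \<in> E ^^ n" "(w, y) \<in> E" by auto
  then show ?case using assms(1) by (blast intro: relpow_Suc_I2 dest: symD)
qed auto

text \<open>For the adjacency relation \<open>E\<close> this is the ball of radius \<open>k\<close>
  in the graph metric. Relation powers let walks be joined by \<open>relpow_add\<close>.\<close>

definition relpow_ball :: "'a rel \<Rightarrow> nat \<Rightarrow> 'a \<Rightarrow> 'a set" where
  "relpow_ball E k u = {v. \<exists>n\<le>k. (u, v) \<in> E ^^ n}"

lemma relpow_ball_self [simp]: "u \<in> relpow_ball E k u"
  by (auto simp: relpow_ball_def intro!: exI[of _ 0])

text \<open>Each vertex of the walk is reached from \<open>u\<close> by a prefix of length at most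
  \<open>k\<close>. The superset \<open>S\<close> of the ball lets walks from different balls be
  joined inside one relation.\<close>

lemma relpow_within_ball:
  assumes "(u, v) \<in> E ^^ n" "n \<le> k" "relpow_ball E k u \<subseteq> S"
  shows "(u, v) \<in> (E \<inter> S \<times> S) ^^ n"
  using assms(1,2)
proof (induction n arbitrary: v)
  case (Suc n)
  then obtain w where w: "(u, w) \<in> E ^^ n" "(w, v) \<in> E" by auto
  have "w \<in> relpow_ball E k u" "v \<in> relpow_ball E k u"
    using w(1) Suc.prems unfolding relpow_ball_def by (blast dest: Suc_leD)+
  then have "(w, v) \<in> E \<inter> S \<times> S" using w assms(3) by auto
  moreover have "(u, w) \<in> (E \<inter> S \<times> S) ^^ n" using Suc w by auto
  ultimately show ?case by (rule relpow_Suc_I[rotated])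
qed auto

text \<open>Remove a middle edge: the two remaining halves have length at most \<open>k\<close>, so
  one stays in the ball of \<open>u\<close> and the other, read backwards, in the ball of
  \<open>v\<close>.\<close>

lemma relpow_within_balls:
  assumes "sym E" "(u, v) \<in> E ^^ n" "n \<le> 2 * k + 1"
    and S: "relpow_ball E k u \<subseteq> S" "relpow_ball E k v \<subseteq> S"
  shows "(u, v) \<in> (E \<inter> S \<times> S) ^^ n"
proof (cases n)
  case 0
  then show ?thesis using assms by auto
next
  case (Suc n')
  \<comment> \<open>Without the middle edge \<open>n' \<le> 2 * k\<close> edges remain, so even the
    longer half \<open>b\<close> has at most \<open>k\<close>.\<close>
  define a b where "a = n' div 2" and "b = n' - a"
  have ab: "n = a + Suc b" "a \<le> k" "b \<le> k"
    using assms(3) Suc by (auto simp: a_def b_def)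
  from assms(2) obtain x y where xy: "(u, x) \<in> E ^^ a" "(x, y) \<in> E" "(y, v) \<in> E ^^ b"
    unfolding ab(1) relpow_add by (blast elim: relpow_Suc_E2)
  have vy: "(v, y) \<in> E ^^ b" using sym_relpow[OF assms(1) xy(3)] .
  let ?Q = "E \<inter> S \<times> S"
  have "sym ?Q" using assms(1) by (auto simp: sym_def)
  have "(u, x) \<in> ?Q ^^ a" using relpow_within_ball[OF xy(1) ab(2) S(1)] .
  moreover have "(x, y) \<in> ?Q"
    using xy(1,2) vy ab(2,3) S by (auto simp: relpow_ball_def)
  moreover have "(y, v) \<in> ?Q ^^ b"
    using sym_relpow[OF \<open>sym ?Q\<close> relpow_within_ball[OF vy ab(3) S(2)]] .
  ultimately show ?thesis
    unfolding ab(1) relpow_add by (blast intro: relpow_Suc_I2)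
qed

section \<open>From relation powers to walks, distances and weak reachability\<close>

context wf_digraph
begin

lemma awalk_cost_one [simp]: "awalk_cost (\<lambda>_. 1) p = real (length p)"
  by (induction p) auto

lemma awalk_imp_relpow: "awalk u p v \<Longrightarrow> (u, v) \<in> arcs_ends G ^^ length p"
proof (induction p arbitrary: u)
  case (Cons e p)
  then show ?case
    by (auto simp: awalk_Cons_iff simp del: relpow.simps
        intro: relpow_Suc_I2[OF in_arcs_imp_in_arcs_ends])
qed (auto simp: awalk_Nil_iff)

lemma relpow_imp_awalk:
  assumes "(u, v) \<in> (arcs_ends G \<inter> S \<times> S) ^^ n" "u \<in> verts G" "u \<in> S"
  shows "\<exists>p. awalk u p v \<and> length p = n \<and> set (awalk_verts u p) \<subseteq> S"
  using assms
proof (induction n arbitrary: u)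
  case 0
  then show ?case by (auto simp: awalk_Nil_iff intro!: exI[of _ "[]"])
next
  case (Suc n)
  then obtain w where w: "(u, w) \<in> arcs_ends G" "w \<in> S" "(w, v) \<in> (arcs_ends G \<inter> S \<times> S) ^^ n"
    by (blast elim: relpow_Suc_E2)
  then obtain p where p: "awalk w p v" "length p = n" "set (awalk_verts w p) \<subseteq> S"
    using Suc.IH adj_in_verts by metis
  obtain e where e: "e \<in> arcs G" "tail G e = u" "head G e = w" using w(1) by auto
  then have "awalk u (e # p) v" "set (awalk_verts u (e # p)) \<subseteq> S"
    using p Suc.prems(3) by (auto simp: awalk_Cons_iff)
  then show ?case using p(2) by (metis length_Cons)
qed

lemma graph_dist_le_iff:
  assumes "u \<in> verts G"
  shows "graph_dist G u v \<le> ereal (real d) \<longleftrightarrow> (\<exists>n\<le>d. (u, v) \<in> arcs_ends G ^^ n)"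
proof
  assume "graph_dist G u v \<le> ereal (real d)"
  \<comment> \<open>The distance is an infimum of walk lengths. A strict bound yields a walk below
    it, and lengths below \<open>d + 1\<close> are at most \<open>d\<close> by integrality.\<close>
  then have "graph_dist G u v < ereal (real d + 1)"
    by (rule le_less_trans) simp
  then obtain p where "awalk u p v" "real (length p) < real d + 1"
    unfolding graph_dist_def \<mu>_def by (auto simp: INF_less_iff)
  then show "\<exists>n\<le>d. (u, v) \<in> arcs_ends G ^^ n"
    using awalk_imp_relpow by (intro exI[of _ "length p"]) auto
next
  assume "\<exists>n\<le>d. (u, v) \<in> arcs_ends G ^^ n"
  then obtain n p where "n \<le> d" "awalk u p v" "length p = n"
    using relpow_imp_awalk[where u = u and v = v and S = UNIV] assms by simp metis
  then show "graph_dist G u v \<le> ereal (real d)"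
    using min_cost_le_walk_cost[of u p v "\<lambda>_. 1"] unfolding graph_dist_def
    by (auto elim: order_trans)
qed

lemma awalk_imp_apath_le:
  assumes "awalk u p v"
  shows "\<exists>q. apath u q v \<and> length q \<le> length p \<and> set (awalk_verts u q) \<subseteq> set (awalk_verts u p)"
proof (intro exI conjI)
  show q: "apath u (awalk_to_apath p) v" using assms by (rule apath_awalk_to_apath)
  \<comment> \<open>With unit weights cost is length, and nonnegative weights ensure that cutting
    out cycles does not increase it.\<close>
  have "awalk_cost (\<lambda>_. 1) (awalk_to_apath p) \<le> awalk_cost (\<lambda>_. 1) p"
    using assms by (rule awalk_to_path_no_neg_cyc_cost) auto
  then show "length (awalk_to_apath p) \<le> length p" by simp
  show "set (awalk_verts u (awalk_to_apath p)) \<subseteq> set (awalk_verts u p)"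
    using awalk_to_apath_subset[OF assms] assms q
    by (auto simp: set_awalk_verts[of _ _ v] apath_def)
qed

text \<open>A walk inside a set \<open>S\<close> with least element \<open>v\<close> is enough:
  cutting out its cycles gives a path that is no longer and still lies in \<open>S\<close>.\<close>

lemma WReach_relpowI:
  assumes "linear_order_on (verts G) \<sigma>" and "(u, v) \<in> (arcs_ends G \<inter> S \<times> S) ^^ n" "n \<le> r"
    and "u \<in> verts G" "u \<in> S" "v \<in> S" and below: "\<And>w. w \<in> S \<Longrightarrow> (v, w) \<in> \<sigma>"
  shows "v \<in> WReach G r \<sigma> u"
proof -
  obtain p where p: "awalk u p v" "length p = n" "set (awalk_verts u p) \<subseteq> S"
    using relpow_imp_awalk assms(2,4,5) by blast
  then obtain q where q: "apath u q v" "length q \<le> r" "set (awalk_verts u q) \<subseteq> S"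
    using awalk_imp_apath_le[OF p(1)] assms(3) by auto
  have "w \<notin> underS \<sigma> v" if "w \<in> S" for w
    using below[OF that] assms(1) by (auto simp: underS_def order_on_defs antisym_def)
  then show ?thesis
    using q below[OF assms(5)] p(1) by (auto simp: WReach_def)
qed

end

section \<open>Colour classes that split into cliques\<close>

lemma induce_with_proj:
  "with_proj H \<restriction> S = with_proj \<lparr>pverts = S, parcs = {e \<in> parcs H. fst e \<in> S \<and> snd e \<in> S}\<rparr>"
  by (simp add: induce_subgraph_def with_proj_def)

lemma disjoint_union_of_complete_fibers:
  assumes "finite (pverts H)"
    and "parcs H = {(u, v). u \<in> pverts H \<and> v \<in> pverts H \<and> u \<noteq> v \<and> m u = m v}"
  shows "disjoint_union_of_complete (with_proj H)"
proof -
  define P where "P = (\<lambda>u. {v \<in> pverts H. m v = m u}) ` pverts H"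
  have "partition_on (verts (with_proj H)) P"
    by (rule partition_onI) (auto simp: P_def disjnt_def)
  moreover have "complete_digraph (card C) (with_proj H \<restriction> C)" if "C \<in> P" for C
    using that assms(1) unfolding induce_with_proj complete_digraph_pair_def assms(2)
    by (auto simp: P_def)
  moreover have "\<forall>(u, v) \<in> arcs_ends (with_proj H). \<exists>C\<in>P. u \<in> C \<and> v \<in> C"
    by (auto simp: P_def assms(2))
  ultimately show ?thesis unfolding disjoint_union_of_complete_def by blast
qed

text \<open>The last two assumptions make adjacency inside a colour class of
  \<open>f \<circ> m\<close> the same as having equal \<open>m\<close>-values, so the fibres of
  \<open>m\<close> are the cliques.\<close>

lemma subcoloring_comp:
  assumes "finite (pverts H)"
    and "parcs H \<subseteq> {(u, v). u \<in> pverts H \<and> v \<in> pverts H \<and> u \<noteq> v}"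
    and "\<And>u. u \<in> pverts H \<Longrightarrow> f (m u) < c"
    and "\<And>u v. (u, v) \<in> parcs H \<Longrightarrow> f (m u) = f (m v) \<Longrightarrow> m u = m v"
    and "\<And>u v. u \<in> pverts H \<Longrightarrow> v \<in> pverts H \<Longrightarrow> u \<noteq> v \<Longrightarrow> m u = m v \<Longrightarrow> (u, v) \<in> parcs H"
  shows "subcoloring (with_proj H) c (f \<circ> m)"
proof -
  have "disjoint_union_of_complete (with_proj H \<restriction> {v \<in> pverts H. f (m v) = i})" for i
  proof -
    define V where "V = {v \<in> pverts H. f (m v) = i}"
    have V: "u \<in> pverts H" "v \<in> pverts H" "f (m u) = f (m v)" if "u \<in> V" "v \<in> V" for u v
      using that by (simp_all add: V_def)
    have "(u, v) \<in> parcs H \<longleftrightarrow> u \<noteq> v \<and> m u = m v" if "u \<in> V" "v \<in> V" for u v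
      using assms(2) assms(4)[of u v] assms(5)[of u v] V[OF that] by blast
    then have "{e \<in> parcs H. fst e \<in> V \<and> snd e \<in> V} = {(u, v). u \<in> V \<and> v \<in> V \<and> u \<noteq> v \<and> m u = m v}"
      by auto
    then have "disjoint_union_of_complete (with_proj H \<restriction> V)"
      unfolding induce_with_proj using assms(1)
      by (intro disjoint_union_of_complete_fibers[where m = m]) (simp_all add: V_def)
    then show ?thesis by (simp only: V_def)
  qed
  then show ?thesis using assms(3) by (simp add: subcoloring_def)
qed

section \<open>Optimal orders and weak reachability between ball minima\<close>

context graph
begin

text \<open>The minimum is attained: a finite vertex set has only finitely many orders, and at least
  one by the well-ordering theorem.\<close>

lemma wcol_obtain_order:
  obtains \<sigma> where "linear_order_on (verts G) \<sigma>"
    and "\<And>u. u \<in> verts G \<Longrightarrow> card (WReach G r \<sigma> u) \<le> wcol G r"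
proof -
  let ?L = "{\<sigma>. linear_order_on (verts G) \<sigma>}"
  have "?L \<subseteq> Pow (verts G \<times> verts G)" by (auto simp: order_on_defs)
  then have "finite ?L" by (rule finite_subset) simp
  moreover have "?L \<noteq> {}"
    using well_order_on[of "verts G"] by (auto simp: well_order_on_def)
  ultimately have "wcol G r \<in> wcol_of_order G r ` ?L"
    unfolding wcol_def by (intro Min_in) auto
  then obtain \<sigma> where "\<sigma> \<in> ?L" "wcol G r = wcol_of_order G r \<sigma>" by auto
  then show thesis
    by (intro that[of \<sigma>]) (auto simp: wcol_of_order_def)
qed

lemma WReach_greedy_coloring:
  assumes \<sigma>: "linear_order_on (verts G) \<sigma>"
    and card: "\<And>u. u \<in> verts G \<Longrightarrow> card (WReach G r \<sigma> u) \<le> c"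
  obtains f :: "'a \<Rightarrow> nat" where "\<And>v. v \<in> verts G \<Longrightarrow> f v < c"
    and "\<And>v w. v \<in> verts G \<Longrightarrow> w \<in> WReach G r \<sigma> v \<Longrightarrow> f w = f v \<Longrightarrow> w = v"
proof -
  define R where "R = {(w, v). v \<in> verts G \<and> w \<in> WReach G r \<sigma> v \<and> w \<noteq> v}"
  have "\<sigma> \<subseteq> verts G \<times> verts G" using \<sigma> by (auto simp: order_on_defs)
  then have "finite \<sigma>" by (rule finite_subset) simp
  then have "wf (\<sigma> - Id)"
    using \<sigma> by (auto intro: partial_order_on_well_order_on simp: linear_order_on_def)
  then have "wf R" by (rule wf_subset) (auto simp: R_def WReach_def)
  moreover have "finite (R\<inverse> `` {v}) \<and> card (R\<inverse> `` {v}) < c" if v: "v \<in> verts G" for v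
  proof -
    have fin: "finite (WReach G r \<sigma> v)" by (simp add: WReach_def)
    \<comment> \<open>The empty walk puts \<open>v\<close> into its own set, so at most
      \<open>c - 1\<close> other vertices are to be avoided and \<open>c\<close> colours
      suffice.\<close>
    have "v \<in> WReach G r \<sigma> v"
      using WReach_relpowI[OF \<sigma>, where u = v and v = v and S = "{v}" and n = 0] v \<sigma> by (auto simp: order_on_defs refl_on_def)
    moreover have "R\<inverse> `` {v} = WReach G r \<sigma> v - {v}" using v by (auto simp: R_def)
    ultimately show ?thesis
      using fin card[OF v] card_Diff1_less[OF fin, of v] by auto
  qed
  ultimately obtain f :: "'a \<Rightarrow> nat" where
    "\<And>v. v \<in> verts G \<Longrightarrow> f v < c" "\<And>v w. v \<in> verts G \<Longrightarrow> (w, v) \<in> R \<Longrightarrow> f w \<noteq> f v"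
    using wf_greedy_coloring[of R "verts G" c] by blast
  then show thesis by (intro that[of f]) (auto simp: R_def)
qed

lemma relpow_ball_subset_verts:
  assumes "u \<in> verts G"
  shows "relpow_ball (arcs_ends G) k u \<subseteq> verts G"
proof
  fix v assume "v \<in> relpow_ball (arcs_ends G) k u"
  then obtain n where "(u, v) \<in> (arcs_ends G \<inter> UNIV \<times> UNIV) ^^ n"
    by (auto simp: relpow_ball_def)
  then show "v \<in> verts G" using relpow_imp_awalk assms by blast
qed

text \<open>The walk \<open>y\<close> - \<open>v\<close> - \<open>u\<close> - \<open>x\<close> stays
  in the union \<open>S\<close> of both balls. Since \<open>x\<close> precedes \<open>y\<close>, it
  is least in all of \<open>S\<close> by transitivity.\<close>

lemma least_of_ball_WReach:
  assumes \<sigma>: "linear_order_on (verts G) \<sigma>"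
    and "(u, v) \<in> arcs_ends G ^^ n" "n \<le> d" "u \<in> verts G"
    and x: "x \<in> relpow_ball (arcs_ends G) (d div 2) u"
      "\<And>w. w \<in> relpow_ball (arcs_ends G) (d div 2) u \<Longrightarrow> (x, w) \<in> \<sigma>"
    and y: "y \<in> relpow_ball (arcs_ends G) (d div 2) v"
      "\<And>w. w \<in> relpow_ball (arcs_ends G) (d div 2) v \<Longrightarrow> (y, w) \<in> \<sigma>"
    and "(x, y) \<in> \<sigma>"
  shows "x \<in> WReach G (2 * d) \<sigma> y"
proof -
  let ?E = "arcs_ends G" and ?k = "d div 2"
  define S where "S = relpow_ball ?E ?k u \<union> relpow_ball ?E ?k v"
  let ?Q = "?E \<inter> S \<times> S"
  have symE: "sym ?E" using sym_arcs by (simp add: symmetric_def)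
  then have symQ: "sym ?Q" by (auto simp: sym_def)
  obtain a b where ab: "a \<le> ?k" "(u, x) \<in> ?E ^^ a" "b \<le> ?k" "(v, y) \<in> ?E ^^ b"
    using x(1) y(1) by (auto simp: relpow_ball_def)
  have "(u, x) \<in> ?Q ^^ a" "(v, y) \<in> ?Q ^^ b"
    using ab relpow_within_ball[where E = ?E and k = ?k and S = S] by (auto simp: S_def)
  moreover have "(u, v) \<in> ?Q ^^ n"
    using assms(2,3) by (intro relpow_within_balls[where k = ?k] symE) (auto simp: S_def)
  ultimately have "(y, x) \<in> ?Q ^^ (b + (n + a))"
    unfolding relpow_add by (blast intro: sym_relpow[OF symQ])
  \<comment> \<open>Here \<open>a\<close> and \<open>b\<close> are at most \<open>d div 2\<close>
    and \<open>n\<close> is at most \<open>d\<close>; this is where the radius \<open>2 * d\<close>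
    comes from.\<close>
  moreover have "b + (n + a) \<le> 2 * d" using ab assms(3) by linarith
  moreover have "v \<in> verts G"
    using relpow_ball_subset_verts[OF \<open>u \<in> verts G\<close>, of n] assms(2) by (auto simp: relpow_ball_def)
  then have "y \<in> verts G" using relpow_ball_subset_verts y(1) by blast
  moreover have "trans \<sigma>" using \<sigma> by (auto simp: order_on_defs)
  then have "(x, w) \<in> \<sigma>" if "w \<in> S" for w
    using that x(2) y(2) \<open>(x, y) \<in> \<sigma>\<close> unfolding S_def by (blast dest: transD)
  moreover have "x \<in> S" "y \<in> S" using x y by (auto simp: S_def)
  ultimately show ?thesis using WReach_relpowI[OF \<sigma>] by blast
qed

end

section \<open>Subcolouring the graph power by the colours of ball minima\<close>

theorem theorem4p1:
  fixes G :: "('a, 'b) pre_digraph" and d :: nat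
  assumes "graph G"
  shows "subchromatic_index (with_proj (graph_power G d)) \<le> wcol G (2 * d)"
proof -
  interpret graph G by fact
  let ?c = "wcol G (2 * d)"
  define B where "B = relpow_ball (arcs_ends G) (d div 2)"
  have symE: "sym (arcs_ends G)" using sym_arcs by (simp add: symmetric_def)
  obtain \<sigma> where \<sigma>: "linear_order_on (verts G) \<sigma>"
    and card: "\<And>u. u \<in> verts G \<Longrightarrow> card (WReach G (2 * d) \<sigma> u) \<le> ?c"
    using wcol_obtain_order[of "2 * d"] by blast
  obtain f :: "'a \<Rightarrow> nat" where f: "\<And>v. v \<in> verts G \<Longrightarrow> f v < ?c"
    "\<And>v w. v \<in> verts G \<Longrightarrow> w \<in> WReach G (2 * d) \<sigma> v \<Longrightarrow> f w = f v \<Longrightarrow> w = v"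
    using WReach_greedy_coloring[OF \<sigma> card] by blast
  have B: "B u \<subseteq> verts G" if "u \<in> verts G" for u
    unfolding B_def using relpow_ball_subset_verts that .
  have "\<exists>x\<in>B u. \<forall>w\<in>B u. (x, w) \<in> \<sigma>" if "u \<in> verts G" for u
    using that B[OF that] finite_subset[OF B[OF that]]
    by (intro linear_order_on_finite_least[OF \<sigma>]) (auto simp: B_def dest: equals0D[of _ u])
  then obtain m where m: "\<And>u. u \<in> verts G \<Longrightarrow> m u \<in> B u"
    "\<And>u w. u \<in> verts G \<Longrightarrow> w \<in> B u \<Longrightarrow> (m u, w) \<in> \<sigma>"
    by metis
  have mV: "m u \<in> verts G" if "u \<in> verts G" for u using m(1) B that by blast
  have arcs: "(u, v) \<in> parcs (graph_power G d) \<longleftrightarrow>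
      u \<in> verts G \<and> v \<in> verts G \<and> u \<noteq> v \<and> (\<exists>n\<le>d. (u, v) \<in> arcs_ends G ^^ n)" for u v
    by (auto simp: graph_power_def graph_dist_le_iff)
  \<comment> \<open>The smaller minimum \<open>m u\<close> is weakly reachable from
    \<open>m v\<close>, and \<open>f\<close> separates distinct vertices related in this
    way.\<close>
  have aux: "m u = m v"
    if "u \<in> verts G" "v \<in> verts G" "(u, v) \<in> arcs_ends G ^^ n" "n \<le> d" "f (m u) = f (m v)"
      "(m u, m v) \<in> \<sigma>" for u v n
    using that m f(2) mV least_of_ball_WReach[OF \<sigma> that(3,4,1), of "m u" "m v"]
    unfolding B_def by blast
  have "subcoloring (with_proj (graph_power G d)) ?c (f \<circ> m)"
  proof (rule subcoloring_comp)
    show "finite (pverts (graph_power G d))"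
      and "parcs (graph_power G d) \<subseteq>
        {(u, v). u \<in> pverts (graph_power G d) \<and> v \<in> pverts (graph_power G d) \<and> u \<noteq> v}"
      by (auto simp: graph_power_def)
    show "f (m u) < ?c" if "u \<in> pverts (graph_power G d)" for u
      using that f(1) mV by (simp add: graph_power_def)
    show "m u = m v" if uv: "(u, v) \<in> parcs (graph_power G d)" and eq: "f (m u) = f (m v)" for u v
    proof -
      obtain n where n: "u \<in> verts G" "v \<in> verts G" "n \<le> d" "(u, v) \<in> arcs_ends G ^^ n"
        using uv arcs by blast
      \<comment> \<open>By totality one of the minima precedes the other; \<open>aux\<close> is
        applied to \<open>u\<close>, \<open>v\<close> or, with the walk reversed, to
        \<open>v\<close>, \<open>u\<close>.\<close>
      have "m u = m v \<or> (m u, m v) \<in> \<sigma> \<or> (m v, m u) \<in> \<sigma>"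
        using \<sigma> mV n by (auto simp: order_on_defs total_on_def)
      then show ?thesis
        using aux[OF n(1,2,4,3)] aux[OF n(2,1) sym_relpow[OF symE n(4)] n(3)] eq by metis
    qed
    show "(u, v) \<in> parcs (graph_power G d)"
      if "u \<in> pverts (graph_power G d)" "v \<in> pverts (graph_power G d)" "u \<noteq> v" "m u = m v" for u v
    proof -
      have uv: "u \<in> verts G" "v \<in> verts G" using that by (auto simp: graph_power_def)
      \<comment> \<open>The common minimum lies in both balls, so two walks of length at most
        \<open>d div 2\<close> meet there and join to one of length at most
        \<open>d\<close>.\<close>
      then obtain a b where ab: "a \<le> d div 2" "(u, m u) \<in> arcs_ends G ^^ a"
          "b \<le> d div 2" "(v, m u) \<in> arcs_ends G ^^ b"
        using m(1)[of u] m(1)[of v] \<open>m u = m v\<close> by (auto simp: B_def relpow_ball_def)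
      then have "(u, v) \<in> arcs_ends G ^^ (a + b)"
        unfolding relpow_add by (blast intro: sym_relpow[OF symE])
      moreover have "a + b \<le> d" using ab by linarith
      ultimately show ?thesis using arcs uv \<open>u \<noteq> v\<close> by blast
    qed
  qed
  then show ?thesis
    unfolding subchromatic_index_def by (blast intro: Least_le)
qed

end
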